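(* On binary constraint networks, dual consistency (DC) is equivalent to path consistency (PC): a binary constraint network $P$ is DC-consistent if and only if it is PC-consistent.
   Context: A constraint network (CN) $P$ consists of a finite set $\mathrm{vars}(P)$ of variables and a finite set $\mathrm{cons}(P)$ of constraints. Each variable $x$ has a finite initial domain $\mathrm{dom}^{\mathrm{init}}(x)$ and a current domain $\mathrm{dom}(x)\subseteq \mathrm{dom}^{\mathrm{init}}(x)$. Each constraint $c$ has a scope $\mathrm{scp}(c)\subseteq\mathrm{vars}(P)$ (its arity is $|\mathrm{scp}(c)|$) and a relation $\mathrm{rel}(c)\subseteq\prod_{x\in \mathrm{scp}(c)}\mathrm{dom}^{\mathrm{init}}(x)$ of allowed tuples. All CNs are normalized (distinct constraints have distinct scopes), have no unary constraint, and no universal constraint (relation equal to the full product of initial domains). A CN is binary if all its constraints have arity 2. A value of $P$ is a pair $(x,a)$ with $x\in\mathrm{vars}(P)$, $a\in\mathrm{dom}(x)$; we write $(x,a)\in P$. If some current domain of $P$ is empty we write $P=\bot$, and by convention $(x,a)\notin\bot$ for every pair $(x,a)$. An instantiation is a set $I=\{(x_1,a_1),\dots,(x_k,a_k)\}$ with distinct variables $x_i$ and $a_i\in\mathrm{dom}^{\mathrm{init}}(x_i)$. It is valid on $P$ if $a_i\in\mathrm{dom}(x_i)$ for all $i$. It is locally consistent on $P$ if it is valid and every constraint of $P$ whose scope is contained in $\{x_1,\dots,x_k\}$ is satisfied by $I$. When writing $\{(x,a),(y,b)\}$ it is assumed that $x\ne y$. A support for $(x,a)$ on a constraint $c$ with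 $x\in\mathrm{scp}(c)$ is a valid instantiation of $\mathrm{scp}(c)$ that satisfies $c$ and contains $(x,a)$. A value $(x,a)$ of $P$ is GAC-consistent if it has a support on every constraint involving $x$; $P$ is GAC-consistent if all its values are. $GAC(P)$ is the CN obtained from $P$ by repeatedly removing from current domains the values that are not GAC-consistent, until a fixed point is reached (the result does not depend on the order); if a domain becomes empty, $GAC(P)=\bot$. $P|_{x=a}$ is obtained from $P$ by removing every value $b\neq a$ from $\mathrm{dom}(x)$. DC: an instantiation $\{(x,a),(y,b)\}$ is DC-consistent on $P$ iff $(y,b)\in GAC(P|_{x=a})$ and $(x,a)\in GAC(P|_{y=b})$. $P$ is DC-consistent iff every locally consistent instantiation $\{(x,a),(y,b)\}$ on $P$ is DC-consistent. PC: an instantiation $\{(x,a),(y,b)\}$ is PC-consistent on $P$ iff for every third variable $z$ of $P$ there is $c\in\mathrm{dom}(z)$ such that $\{(x,a),(z,c)\}$ and $\{(y,b),(z,c)\}$ are both locally consistent. $P$ is PC-consistent iff every locally consistent instantiation $\{(x,a),(y,b)\}$ on $P$ is PC-consistent. *)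

theory Defs
  imports "HOL-Library.FuncSet"
begin

(* A tuple of the product of the domains of a scope is a function that is undefined
   outside the scope, i.e. an element of a PiE product. *)

record ('v, 'a) constr =
  scp :: "'v set"
  rel :: "('v \<Rightarrow> 'a) set"

record ('v, 'a) cn =
  vars :: "'v set"
  dom_init :: "'v \<Rightarrow> 'a set"
  cdom :: "'v \<Rightarrow> 'a set"
  cons :: "('v, 'a) constr set"

definition constraint_network :: "('v, 'a) cn \<Rightarrow> bool" where
  "constraint_network P \<longleftrightarrow>
     finite (vars P) \<and> finite (cons P) \<and>
     (\<forall>x\<in>vars P. finite (dom_init P x) \<and> cdom P x \<subseteq> dom_init P x) \<and>
     (\<forall>c\<in>cons P. scp c \<subseteq> vars P \<and> rel c \<subseteq> PiE (scp c) (dom_init P)) \<and>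
     inj_on scp (cons P) \<and>
     (\<forall>c\<in>cons P. card (scp c) \<noteq> 1) \<and>
     (\<forall>c\<in>cons P. rel c \<noteq> PiE (scp c) (dom_init P))"

definition binary_cn :: "('v, 'a) cn \<Rightarrow> bool" where
  "binary_cn P \<longleftrightarrow> (\<forall>c\<in>cons P. card (scp c) = 2)"

(* P = bottom is a property of P, not a distinguished network. *)

definition is_bot :: "('v, 'a) cn \<Rightarrow> bool" where
  "is_bot P \<longleftrightarrow> (\<exists>x\<in>vars P. cdom P x = {})"

definition value_in :: "'v \<times> 'a \<Rightarrow> ('v, 'a) cn \<Rightarrow> bool" where
  "value_in v P \<longleftrightarrow> \<not> is_bot P \<and> fst v \<in> vars P \<and> snd v \<in> cdom P (fst v)"

definition instantiation_on :: "('v, 'a) cn \<Rightarrow> ('v \<times> 'a) set \<Rightarrow> bool" where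
  "instantiation_on P I \<longleftrightarrow> single_valued I \<and> (\<forall>(x, a)\<in>I. x \<in> vars P \<and> a \<in> dom_init P x)"

definition valid_inst :: "('v, 'a) cn \<Rightarrow> ('v \<times> 'a) set \<Rightarrow> bool" where
  "valid_inst P I \<longleftrightarrow> instantiation_on P I \<and> (\<forall>(x, a)\<in>I. a \<in> cdom P x)"

(* The restriction of I to the scope of c is an allowed tuple. *)

definition satisfies :: "('v \<times> 'a) set \<Rightarrow> ('v, 'a) constr \<Rightarrow> bool" where
  "satisfies I c \<longleftrightarrow> (\<exists>t\<in>rel c. \<forall>x\<in>scp c. (x, t x) \<in> I)"

definition locally_consistent :: "('v, 'a) cn \<Rightarrow> ('v \<times> 'a) set \<Rightarrow> bool" where
  "locally_consistent P I \<longleftrightarrow>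
     valid_inst P I \<and> (\<forall>c\<in>cons P. scp c \<subseteq> Domain I \<longrightarrow> satisfies I c)"

definition is_support :: "('v, 'a) cn \<Rightarrow> ('v, 'a) constr \<Rightarrow> 'v \<times> 'a \<Rightarrow> ('v \<times> 'a) set \<Rightarrow> bool" where
  "is_support P c v I \<longleftrightarrow> valid_inst P I \<and> Domain I = scp c \<and> satisfies I c \<and> v \<in> I"

definition GAC_consistent_value :: "('v, 'a) cn \<Rightarrow> 'v \<times> 'a \<Rightarrow> bool" where
  "GAC_consistent_value P v \<longleftrightarrow>
     (\<forall>c\<in>cons P. fst v \<in> scp c \<longrightarrow> (\<exists>I. is_support P c v I))"

definition remove_value :: "('v, 'a) cn \<Rightarrow> 'v \<times> 'a \<Rightarrow> ('v, 'a) cn" where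
  "remove_value P v = P\<lparr>cdom := (cdom P)(fst v := cdom P (fst v) - {snd v})\<rparr>"

(* Membership in the current domain is tested directly rather than with value_in, so removal
   goes on after a domain has become empty. The empty domain stays empty, so the outcome is
   still bottom, and the fixed point is unique. *)

definition GAC_step :: "('v, 'a) cn \<Rightarrow> ('v, 'a) cn \<Rightarrow> bool" where
  "GAC_step P Q \<longleftrightarrow>
     (\<exists>x\<in>vars P. \<exists>a\<in>cdom P x. \<not> GAC_consistent_value P (x, a) \<and> Q = remove_value P (x, a))"

definition GAC_fixpoint :: "('v, 'a) cn \<Rightarrow> ('v, 'a) cn \<Rightarrow> bool" where
  "GAC_fixpoint P Q \<longleftrightarrow> GAC_step\<^sup>*\<^sup>* P Q \<and> (\<nexists>R. GAC_step Q R)"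

definition GAC :: "('v, 'a) cn \<Rightarrow> ('v, 'a) cn" where
  "GAC P = (THE Q. GAC_fixpoint P Q)"

definition restrict_var :: "('v, 'a) cn \<Rightarrow> 'v \<Rightarrow> 'a \<Rightarrow> ('v, 'a) cn" where
  "restrict_var P x a = P\<lparr>cdom := (cdom P)(x := cdom P x - {b. b \<noteq> a})\<rparr>"

definition DC_consistent_inst :: "('v, 'a) cn \<Rightarrow> 'v \<times> 'a \<Rightarrow> 'v \<times> 'a \<Rightarrow> bool" where
  "DC_consistent_inst P v w \<longleftrightarrow>
     value_in w (GAC (restrict_var P (fst v) (snd v))) \<and>
     value_in v (GAC (restrict_var P (fst w) (snd w)))"

definition DC_consistent :: "('v, 'a) cn \<Rightarrow> bool" where
  "DC_consistent P \<longleftrightarrow>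
     (\<forall>x a y b. x \<noteq> y \<longrightarrow> locally_consistent P {(x, a), (y, b)} \<longrightarrow>
        DC_consistent_inst P (x, a) (y, b))"

definition PC_consistent_inst :: "('v, 'a) cn \<Rightarrow> 'v \<times> 'a \<Rightarrow> 'v \<times> 'a \<Rightarrow> bool" where
  "PC_consistent_inst P v w \<longleftrightarrow>
     (\<forall>z\<in>vars P - {fst v, fst w}. \<exists>c\<in>cdom P z.
        locally_consistent P {v, (z, c)} \<and> locally_consistent P {w, (z, c)})"

definition PC_consistent :: "('v, 'a) cn \<Rightarrow> bool" where
  "PC_consistent P \<longleftrightarrow>
     (\<forall>x a y b. x \<noteq> y \<longrightarrow> locally_consistent P {(x, a), (y, b)} \<longrightarrow>
        PC_consistent_inst P (x, a) (y, b))"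

(* The description defining GAC denotes: removal terminates, in a result independent of the order. *)

definition sub_cn :: "('v, 'a) cn \<Rightarrow> ('v, 'a) cn \<Rightarrow> bool" where
  "sub_cn Q P \<longleftrightarrow> (\<exists>D. Q = P\<lparr>cdom := D\<rparr> \<and> (\<forall>x. D x \<subseteq> cdom P x))"

lemma sub_cn_refl: "sub_cn P P"
  unfolding sub_cn_def by (rule exI[of _ "cdom P"]) simp

lemma sub_cn_trans:
  assumes "sub_cn R Q" "sub_cn Q P"
  shows "sub_cn R P"
proof -
  obtain D where D: "Q = P\<lparr>cdom := D\<rparr>" "\<And>x. D x \<subseteq> cdom P x"
    using assms(2) unfolding sub_cn_def by blast
  obtain E where E: "R = Q\<lparr>cdom := E\<rparr>" "\<And>x. E x \<subseteq> cdom Q x"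
    using assms(1) unfolding sub_cn_def by blast
  have "R = P\<lparr>cdom := E\<rparr>" "\<forall>x. E x \<subseteq> cdom P x"
    using D E by (simp, auto)
  then show ?thesis
    unfolding sub_cn_def by blast
qed

lemma sub_cn_antisym:
  assumes "sub_cn P Q" "sub_cn Q P"
  shows "P = Q"
proof -
  obtain D where D: "Q = P\<lparr>cdom := D\<rparr>" "\<And>x. D x \<subseteq> cdom P x"
    using assms(2) unfolding sub_cn_def by blast
  have "cdom P x \<subseteq> D x" for x
    using assms(1) D(1) unfolding sub_cn_def by (metis cn.select_convs(3) cn.surjective cn.update_convs(3))
  then have "D = cdom P"
    using D(2) by blast
  with D(1) show ?thesis
    by simp
qed

lemma GAC_step_sub: "GAC_step P Q \<Longrightarrow> sub_cn Q P"
  unfolding GAC_step_def sub_cn_def remove_value_def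
  by (elim bexE conjE, intro exI[of _ "cdom Q"]) (simp add: Diff_subset)

lemma GAC_steps_sub: "GAC_step\<^sup>*\<^sup>* P Q \<Longrightarrow> sub_cn Q P"
  by (induction rule: rtranclp_induct) (auto intro: sub_cn_refl sub_cn_trans GAC_step_sub)

lemma GAC_consistent_value_mono:
  assumes "sub_cn Q P" "GAC_consistent_value Q v"
  shows "GAC_consistent_value P v"
proof -
  obtain D where D: "Q = P\<lparr>cdom := D\<rparr>" "\<And>x. D x \<subseteq> cdom P x"
    using assms(1) unfolding sub_cn_def by blast
  have "valid_inst P I" if "valid_inst Q I" for I
    using that D(2) unfolding D(1) valid_inst_def instantiation_on_def by fastforce
  then have "is_support P c v I" if "is_support Q c v I" for c I
    using that unfolding is_support_def by blast
  moreover have "cons Q = cons P"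
    using D(1) by simp
  ultimately show ?thesis
    using assms(2) unfolding GAC_consistent_value_def by metis
qed

lemma GAC_normal_below_step:
  assumes "\<nexists>R. GAC_step N R" "sub_cn N P" "GAC_step P Q"
  shows "sub_cn N Q"
proof -
  obtain x a where xa: "x \<in> vars P" "\<not> GAC_consistent_value P (x, a)"
    and Q: "Q = remove_value P (x, a)"
    using assms(3) unfolding GAC_step_def by blast
  obtain D where D: "N = P\<lparr>cdom := D\<rparr>" "\<forall>x. D x \<subseteq> cdom P x"
    using assms(2) unfolding sub_cn_def by blast
  have "\<not> GAC_consistent_value N (x, a)"
    using xa(2) GAC_consistent_value_mono[OF assms(2)] by blast
  then have "a \<notin> D x"
    using assms(1) xa(1) D(1) unfolding GAC_step_def by auto
  then show ?thesis
    using D unfolding sub_cn_def Q remove_value_def by (intro exI[of _ D]) auto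
qed

lemma GAC_normal_below_steps:
  assumes "GAC_step\<^sup>*\<^sup>* P Q" "\<nexists>R. GAC_step N R" "sub_cn N P"
  shows "sub_cn N Q"
  using assms by (induction rule: rtranclp_induct) (auto intro: GAC_normal_below_step)

lemma GAC_fixpoint_unique: "GAC_fixpoint P Q \<Longrightarrow> GAC_fixpoint P R \<Longrightarrow> Q = R"
  unfolding GAC_fixpoint_def
  by (meson GAC_normal_below_steps GAC_steps_sub sub_cn_antisym)

lemma GAC_fixpoint_exists:
  assumes "finite (vars P)" "\<forall>x\<in>vars P. finite (cdom P x)"
  shows "\<exists>Q. GAC_fixpoint P Q"
  using assms
proof (induction "card (Sigma (vars P) (cdom P))" arbitrary: P rule: less_induct)
  case less
  show ?case
  proof (cases "\<exists>R. GAC_step P R")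
    case True
    then obtain x a where xa: "x \<in> vars P" "a \<in> cdom P x"
      and step: "GAC_step P (remove_value P (x, a))"
      unfolding GAC_step_def by blast
    let ?R = "remove_value P (x, a)"
    have "Sigma (vars ?R) (cdom ?R) \<subseteq> Sigma (vars P) (cdom P) - {(x, a)}"
      unfolding remove_value_def by (auto split: if_splits)
    moreover have "(x, a) \<in> Sigma (vars P) (cdom P)"
      using xa by simp
    ultimately have "Sigma (vars ?R) (cdom ?R) \<subset> Sigma (vars P) (cdom P)"
      by blast
    then have "card (Sigma (vars ?R) (cdom ?R)) < card (Sigma (vars P) (cdom P))"
      using less.prems by (intro psubset_card_mono) auto
    moreover have "finite (vars ?R)" "\<forall>x\<in>vars ?R. finite (cdom ?R x)"
      using less.prems unfolding remove_value_def by auto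
    ultimately obtain Q where "GAC_fixpoint ?R Q"
      using less.hyps by blast
    then show ?thesis
      using step unfolding GAC_fixpoint_def by (meson converse_rtranclp_into_rtranclp)
  next
    case False
    then show ?thesis
      unfolding GAC_fixpoint_def by blast
  qed
qed

lemma GAC_fixpoint_GAC:
  assumes "finite (vars P)" "\<forall>x\<in>vars P. finite (cdom P x)"
  shows "GAC_fixpoint P (GAC P)"
  unfolding GAC_def
  using GAC_fixpoint_exists[OF assms] GAC_fixpoint_unique by (metis theI)

end

theory Submission
  imports Defs
begin

(* Once no domain is empty, a value of a binary network is GAC-consistent iff it extends, for
   every other variable, to a locally consistent pair: where there is no constraint any pair will do.
   Hence, for a path consistent network, the values forming a locally consistent pair with (x, a)
   are closed under GAC and so survive in GAC (P|x=a). Conversely, every value that survives there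
   is compatible with (x, a), so a support of (y, b) inside GAC (P|x=a) witnesses path consistency. *)

section \<open>Locally consistent pairs and supports in binary networks\<close>

lemma locally_consistent_pair_iff:
  assumes "constraint_network P" "binary_cn P" "x \<noteq> y"
  shows "locally_consistent P {(x, a), (y, b)} \<longleftrightarrow>
    x \<in> vars P \<and> y \<in> vars P \<and> a \<in> cdom P x \<and> b \<in> cdom P y \<and>
    (\<forall>c\<in>cons P. scp c = {x, y} \<longrightarrow> satisfies {(x, a), (y, b)} c)"
proof -
  \<comment> \<open>Both sets have two elements, so inclusion forces equality: no constraint on
    fewer variables has to be tested.\<close>
  have "scp c \<subseteq> {x, y} \<longleftrightarrow> scp c = {x, y}" if "c \<in> cons P" for c
  proof -
    have "card (scp c) = card {x, y}"
      using that assms(2,3) unfolding binary_cn_def by simp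
    then show ?thesis
      by (metis card_subset_eq finite.emptyI finite.insertI order_refl)
  qed
  moreover have "valid_inst P {(x, a), (y, b)} \<longleftrightarrow>
      x \<in> vars P \<and> y \<in> vars P \<and> a \<in> cdom P x \<and> b \<in> cdom P y"
    using assms(1,3)
    unfolding valid_inst_def instantiation_on_def constraint_network_def single_valued_def
    by auto
  ultimately show ?thesis
    unfolding locally_consistent_def by auto
qed

lemma single_valued_Domain_pair:
  assumes "single_valued I" "Domain I = {x, y}" "(x, a) \<in> I"
  obtains b where "I = {(x, a), (y, b)}"
proof -
  obtain b where b: "(y, b) \<in> I"
    using assms(2) by blast
  have "I = {(x, a), (y, b)}"
  proof (intro set_eqI iffI)
    fix v assume v: "v \<in> I"
    then have "fst v \<in> {x, y}"
      using assms(2) by (metis DomainI prod.collapse)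
    then show "v \<in> {(x, a), (y, b)}"
      using assms(1,3) b v by (cases v) (auto dest: single_valuedD)
  qed (use assms(3) b in auto)
  then show thesis ..
qed

text \<open>Shrinking domains leaves the constraints alone, so local consistency can always be
  judged in \<open>P\<close>; the reduced domains only restrict where \<open>b\<close> is sought.
  This reduces statements about GAC to statements about the sets \<open>D z\<close>.\<close>

lemma support_iff_locally_consistent:
  assumes cn: "constraint_network P" "binary_cn P"
    and sub: "\<forall>z. D z \<subseteq> cdom P z"
    and c: "c \<in> cons P" "scp c = {x, y}" "x \<noteq> y"
    and a: "a \<in> D x"
  shows "(\<exists>I. is_support (P\<lparr>cdom := D\<rparr>) c (x, a) I) \<longleftrightarrow>
    (\<exists>b\<in>D y. locally_consistent P {(x, a), (y, b)})"
proof
  have vars: "x \<in> vars P" "y \<in> vars P"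
    using cn(1) c unfolding constraint_network_def by auto
  \<comment> \<open>Normalization: satisfying \<open>c\<close> alone settles local consistency of a
    pair on its scope.\<close>
  have unique: "c' = c" if "c' \<in> cons P" "scp c' = {x, y}" for c'
    using cn(1) c that unfolding constraint_network_def inj_on_def by metis
  show "\<exists>b\<in>D y. locally_consistent P {(x, a), (y, b)}"
    if "\<exists>I. is_support (P\<lparr>cdom := D\<rparr>) c (x, a) I"
  proof -
    from that obtain I where I: "is_support (P\<lparr>cdom := D\<rparr>) c (x, a) I" ..
    then have "single_valued I" "Domain I = {x, y}" "(x, a) \<in> I"
      using c(2) unfolding is_support_def valid_inst_def instantiation_on_def by auto
    then obtain b where b: "I = {(x, a), (y, b)}"
      by (rule single_valued_Domain_pair)
    then have "b \<in> D y" "satisfies {(x, a), (y, b)} c"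
      using I unfolding is_support_def valid_inst_def by auto
    then show ?thesis
      using locally_consistent_pair_iff[OF cn c(3)] vars a sub unique by blast
  qed
  show "\<exists>I. is_support (P\<lparr>cdom := D\<rparr>) c (x, a) I"
    if "\<exists>b\<in>D y. locally_consistent P {(x, a), (y, b)}"
  proof -
    from that obtain b where b: "b \<in> D y" "locally_consistent P {(x, a), (y, b)}" ..
    then have "is_support (P\<lparr>cdom := D\<rparr>) c (x, a) {(x, a), (y, b)}"
      using a c
      unfolding is_support_def locally_consistent_def valid_inst_def instantiation_on_def
      by auto
    then show ?thesis ..
  qed
qed

lemma GAC_consistent_value_iff:
  assumes cn: "constraint_network P" "binary_cn P"
    and sub: "\<forall>z. D z \<subseteq> cdom P z"
    and ne: "\<forall>z\<in>vars P. D z \<noteq> {}"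
    and x: "x \<in> vars P" "a \<in> D x"
  shows "GAC_consistent_value (P\<lparr>cdom := D\<rparr>) (x, a) \<longleftrightarrow>
    (\<forall>y\<in>vars P - {x}. \<exists>b\<in>D y. locally_consistent P {(x, a), (y, b)})"
proof (intro iffI ballI)
  fix y assume gac: "GAC_consistent_value (P\<lparr>cdom := D\<rparr>) (x, a)" and y: "y \<in> vars P - {x}"
  then have xy: "x \<noteq> y" by blast
  show "\<exists>b\<in>D y. locally_consistent P {(x, a), (y, b)}"
  proof (cases "\<exists>c\<in>cons P. scp c = {x, y}")
    case True
    then obtain c where c: "c \<in> cons P" "scp c = {x, y}" ..
    then have "\<exists>I. is_support (P\<lparr>cdom := D\<rparr>) c (x, a) I"
      using gac unfolding GAC_consistent_value_def by simp
    then show ?thesis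
      using support_iff_locally_consistent[where D = D, OF cn sub c xy x(2)] by blast
  next
    case False
    \<comment> \<open>Without a constraint on \<open>{x, y}\<close> only validity is at stake, and
      \<open>ne\<close> supplies a value.\<close>
    obtain b where "b \<in> D y"
      using ne y by blast
    then show ?thesis
      using False locally_consistent_pair_iff[OF cn xy] x y sub by blast
  qed
next
  assume compat: "\<forall>y\<in>vars P - {x}. \<exists>b\<in>D y. locally_consistent P {(x, a), (y, b)}"
  show "GAC_consistent_value (P\<lparr>cdom := D\<rparr>) (x, a)"
    unfolding GAC_consistent_value_def
  proof (intro ballI impI)
    fix c assume "c \<in> cons (P\<lparr>cdom := D\<rparr>)" "fst (x, a) \<in> scp c"
    then have c: "c \<in> cons P" "x \<in> scp c" by simp_all
    then have "card (scp c) = 2"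
      using cn(2) unfolding binary_cn_def by blast
    then obtain y where y: "scp c = {x, y}" "x \<noteq> y"
      using c(2) unfolding card_2_iff by (metis insertE insert_commute singletonD)
    then have "y \<in> vars P - {x}"
      using cn(1) c(1) unfolding constraint_network_def by blast
    then show "\<exists>I. is_support (P\<lparr>cdom := D\<rparr>) c (x, a) I"
      using support_iff_locally_consistent[where D = D, OF cn sub c(1) y x(2)] compat by blast
  qed
qed

section \<open>GAC after the assignment of one variable\<close>

lemma GAC_restrict_var_fixpoint:
  assumes "constraint_network P"
  shows "GAC_fixpoint (restrict_var P x a) (GAC (restrict_var P x a))"
proof (rule GAC_fixpoint_GAC)
  show "finite (vars (restrict_var P x a))"
    using assms unfolding constraint_network_def restrict_var_def by simp
  show "\<forall>z\<in>vars (restrict_var P x a). finite (cdom (restrict_var P x a) z)"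
    using assms unfolding constraint_network_def restrict_var_def
    by (auto intro: finite_subset)
qed

text \<open>Removal changes nothing but current domains, so the outcome is \<open>P\<close> with
  smaller domains \<open>D\<close>, and \<open>D x\<close> stays within the restricted domain of
  \<open>x\<close>. No step leaves a fixed point, so all remaining values are
  GAC-consistent.\<close>

lemma GAC_restrict_var_closed:
  assumes cn: "constraint_network P" "binary_cn P"
    and "\<not> is_bot (GAC (restrict_var P x a))"
  obtains D where
    "GAC (restrict_var P x a) = P\<lparr>cdom := D\<rparr>"
    "\<forall>z. D z \<subseteq> cdom P z" "D x \<subseteq> {a}"
    "\<forall>y\<in>vars P. \<forall>b\<in>D y. \<forall>z\<in>vars P - {y}.
      \<exists>c\<in>D z. locally_consistent P {(y, b), (z, c)}"
proof -
  let ?Q = "GAC (restrict_var P x a)"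
  have fix_Q: "GAC_fixpoint (restrict_var P x a) ?Q"
    by (rule GAC_restrict_var_fixpoint[OF cn(1)])
  then have "sub_cn ?Q (restrict_var P x a)"
    unfolding GAC_fixpoint_def by (blast intro: GAC_steps_sub)
  then obtain D where D: "?Q = (restrict_var P x a)\<lparr>cdom := D\<rparr>"
      "\<forall>z. D z \<subseteq> cdom (restrict_var P x a) z"
    unfolding sub_cn_def by blast
  have Q: "?Q = P\<lparr>cdom := D\<rparr>"
    using D(1) unfolding restrict_var_def by simp
  have sub: "\<forall>z. D z \<subseteq> cdom P z" and Dx: "D x \<subseteq> {a}"
    using D(2) unfolding restrict_var_def by (force split: if_splits)+
  have ne: "\<forall>z\<in>vars P. D z \<noteq> {}"
    using assms(3) unfolding Q is_bot_def by simp
  have "\<exists>c\<in>D z. locally_consistent P {(y, b), (z, c)}"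
    if "y \<in> vars P" "b \<in> D y" "z \<in> vars P - {y}" for y b z
  proof -
    have "GAC_consistent_value (P\<lparr>cdom := D\<rparr>) (y, b)"
      using fix_Q that unfolding Q GAC_fixpoint_def GAC_step_def by auto
    then show ?thesis
      using GAC_consistent_value_iff[where D = D, OF cn sub ne that(1,2)] that(3) by blast
  qed
  with Q sub Dx show thesis using that by blast
qed

section \<open>The two implications\<close>

lemma DC_imp_PC:
  assumes cn: "constraint_network P" "binary_cn P" and dc: "DC_consistent P"
  shows "PC_consistent P"
  unfolding PC_consistent_def PC_consistent_inst_def
proof (intro allI impI ballI)
  fix x a y b z
  assume xy: "x \<noteq> y" and lc: "locally_consistent P {(x, a), (y, b)}"
    and "z \<in> vars P - {fst (x, a), fst (y, b)}"
  then have z: "z \<in> vars P" "z \<noteq> x" "z \<noteq> y" by auto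
  have val: "value_in (y, b) (GAC (restrict_var P x a))"
    using dc xy lc unfolding DC_consistent_def DC_consistent_inst_def by fastforce
  then have "\<not> is_bot (GAC (restrict_var P x a))"
    unfolding value_in_def by blast
  then obtain D where Q: "GAC (restrict_var P x a) = P\<lparr>cdom := D\<rparr>"
    and D: "\<forall>z. D z \<subseteq> cdom P z" "D x \<subseteq> {a}"
    and closed: "\<forall>y\<in>vars P. \<forall>b\<in>D y. \<forall>z\<in>vars P - {y}.
      \<exists>c\<in>D z. locally_consistent P {(y, b), (z, c)}"
    using GAC_restrict_var_closed[OF cn] by blast
  have y: "y \<in> vars P" "b \<in> D y"
    using val unfolding Q value_in_def by simp_all
  have x: "x \<in> vars P"
    using lc locally_consistent_pair_iff[OF cn xy] by blast
  \<comment> \<open>The witness is taken from \<open>D z\<close> rather than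
    \<open>cdom P z\<close>: as a surviving value it can itself be extended back to
    \<open>x\<close>.\<close>
  obtain c where c: "c \<in> D z" "locally_consistent P {(y, b), (z, c)}"
    using closed y z by blast
  \<comment> \<open>Only \<open>a\<close> can occur here, since
    \<open>D x \<subseteq> {a}\<close>.\<close>
  obtain a' where "a' \<in> D x" "locally_consistent P {(z, c), (x, a')}"
    using closed z(1) c(1) x z(2) by blast
  then have "locally_consistent P {(x, a), (z, c)}"
    using D(2) by (auto simp: insert_commute)
  then show "\<exists>c\<in>cdom P z. locally_consistent P {(x, a), (z, c)} \<and>
      locally_consistent P {(y, b), (z, c)}"
    using c D(1) by blast
qed

text \<open>GAC never removes a value of a subnetwork that admits no removal itself
  (\<open>GAC_normal_below_steps\<close>). So it suffices to exhibit such a subnetwork of the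
  restricted network, with \<open>b\<close> in the domain of \<open>y\<close>.\<close>

lemma PC_imp_value_in_GAC_restrict_var:
  assumes cn: "constraint_network P" "binary_cn P" and pc: "PC_consistent P"
    and xy: "x \<noteq> y" and lc: "locally_consistent P {(x, a), (y, b)}"
  shows "value_in (y, b) (GAC (restrict_var P x a))"
proof -
  \<comment> \<open>The values compatible with \<open>(x, a)\<close>; the separate clause for
    \<open>x\<close> avoids pairs that repeat a variable.\<close>
  define D where
    "D z = (if z = x then {a} else {c. locally_consistent P {(x, a), (z, c)}})" for z
  let ?N = "P\<lparr>cdom := D\<rparr>"
  have x: "x \<in> vars P" "a \<in> cdom P x" and y: "y \<in> vars P"
    using lc locally_consistent_pair_iff[OF cn xy] by blast+
  \<comment> \<open>Path consistency of the pair \<open>{(x, a), (z, c)}\<close> at the third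
    variable \<open>w\<close>: compatibility of \<open>d\<close> with \<open>(x, a)\<close> is
    exactly membership in \<open>D w\<close>.\<close>
  have third: "\<exists>d\<in>D w. locally_consistent P {(z, c), (w, d)}"
    if "z \<noteq> x" "c \<in> D z" "w \<in> vars P - {x, z}" for z c w
  proof -
    have "locally_consistent P {(x, a), (z, c)}"
      using that(1,2) unfolding D_def by simp
    then have "PC_consistent_inst P (x, a) (z, c)"
      using pc that(1) unfolding PC_consistent_def by (metis (no_types))
    then show ?thesis
      using that(3) unfolding PC_consistent_inst_def D_def by auto
  qed
  have yb: "b \<in> D y"
    using lc xy unfolding D_def by simp
  have ne: "\<forall>z\<in>vars P. D z \<noteq> {}"
  proof
    fix z assume z: "z \<in> vars P"
    consider "z = x" | "z = y" | "z \<in> vars P - {x, y}"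
      using z by blast
    then show "D z \<noteq> {}"
    proof cases
      case 1
      then show ?thesis unfolding D_def by simp
    next
      case 2
      then show ?thesis using yb by blast
    next
      case 3
      then show ?thesis using third[OF xy[symmetric] yb] by blast
    qed
  qed
  have sub: "\<forall>z. D z \<subseteq> cdom P z"
    using x locally_consistent_pair_iff[OF cn] unfolding D_def by auto
  have "GAC_consistent_value ?N (z, c)" if z: "z \<in> vars P" "c \<in> D z" for z c
    unfolding GAC_consistent_value_iff[where D = D, OF cn sub ne z]
  proof
    fix w assume w: "w \<in> vars P - {z}"
    \<comment> \<open>Starting from \<open>x\<close>, every element of \<open>D w\<close> fits by
      definition; going back to \<open>x\<close>, the value \<open>a\<close> does; otherwise
      \<open>third\<close> applies.\<close>
    consider "z = x" | "w = x" "z \<noteq> x" | "z \<noteq> x" "w \<noteq> x"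
      by blast
    then show "\<exists>d\<in>D w. locally_consistent P {(z, c), (w, d)}"
    proof cases
      case 1
      obtain d where "d \<in> D w"
        using ne w by blast
      then show ?thesis
        using 1 w z(2) unfolding D_def by auto
    next
      case 2
      then show ?thesis
        using z(2) unfolding D_def by (simp add: insert_commute)
    next
      case 3
      then show ?thesis
        using third z(2) w by blast
    qed
  qed
  then have normal: "\<nexists>R. GAC_step ?N R"
    unfolding GAC_step_def by auto
  have "?N = (restrict_var P x a)\<lparr>cdom := D\<rparr>"
    unfolding restrict_var_def by simp
  moreover have "\<forall>z. D z \<subseteq> cdom (restrict_var P x a) z"
    using sub x(2) D_def[of x] unfolding restrict_var_def by simp
  ultimately have "sub_cn ?N (restrict_var P x a)"
    unfolding sub_cn_def by blast
  then have "sub_cn ?N (GAC (restrict_var P x a))"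
    using GAC_restrict_var_fixpoint[OF cn(1)] normal
    unfolding GAC_fixpoint_def by (blast intro: GAC_normal_below_steps)
  then obtain E where E: "?N = (GAC (restrict_var P x a))\<lparr>cdom := E\<rparr>"
      "\<forall>z. E z \<subseteq> cdom (GAC (restrict_var P x a)) z"
    unfolding sub_cn_def by blast
  \<comment> \<open>Comparing record fields puts each \<open>D z\<close> inside the domain left by
    GAC; as the sets \<open>D z\<close> are nonempty for variables, the result is not
    bottom.\<close>
  have "E = D"
    using arg_cong[OF E(1), of cdom] by simp
  moreover have "vars (GAC (restrict_var P x a)) = vars P"
    using arg_cong[OF E(1), of vars] by simp
  ultimately show ?thesis
    using E(2) ne y yb unfolding value_in_def is_bot_def by (simp, blast)
qed

theorem proposition8:
  fixes P :: "('v, 'a) cn"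
  assumes "constraint_network P"
    and "binary_cn P"
  shows "DC_consistent P \<longleftrightarrow> PC_consistent P"
proof
  show "PC_consistent P" if "DC_consistent P"
    using assms that by (rule DC_imp_PC)
  show "DC_consistent P" if "PC_consistent P"
    unfolding DC_consistent_def DC_consistent_inst_def
    \<comment> \<open>The second half of DC-consistency is the same lemma with the two values
      exchanged, the pair being an unordered set.\<close>
    using PC_imp_value_in_GAC_restrict_var[OF assms that] by (auto simp: insert_commute)
qed

end
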